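(* Let $X_G$ be the shift space generated by a two-dimensional graph $G=(H,V)$, where neither adjacency matrix $H$ nor $V$ has a zero row or a zero column. If for all indices $i,j$ one has $(HV)_{ij}\neq 0 \iff (VH)_{ij}\neq 0$, then $X_G\neq\emptyset$.
   Context: A two-dimensional graph is a pair $G=(H,V)$ of directed graphs (at most one edge for each ordered pair of vertices, loops allowed) on a common finite nonempty vertex set $\mathcal{V}$; $H$ and $V$ also denote their $0$-$1$ adjacency matrices indexed by $\mathcal{V}$. The shift space generated by $G$ is $$X_G=\{x\in\mathcal{V}^{\mathbb{Z}^2}: H_{x(i,j),x(i+1,j)}=1 \text{ and } V_{x(i,j),x(i,j+1)}=1 \text{ for all } (i,j)\in\mathbb{Z}^2\}.$$ *)

theory Defs
  imports "HOL-Analysis.Analysis"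
begin

text \<open>
  The finite nonempty vertex set is the universe of a type \<open>'v::finite\<close>. A directed graph with at
  most one edge for each ordered pair of vertices, loops allowed, is its set of edges. A
  two-dimensional graph is a pair of a horizontal and a vertical directed graph.
\<close>

type_synonym 'v two_dim_graph = "'v rel \<times> 'v rel"

definition adjacency_matrix :: "'v::finite rel \<Rightarrow> int ^ 'v ^ 'v" where
  "adjacency_matrix E = (\<chi> u v. if (u, v) \<in> E then 1 else 0)"

definition shift_space :: "'v::finite two_dim_graph \<Rightarrow> (int \<times> int \<Rightarrow> 'v) set" where
  "shift_space G = {x. \<forall>i j.
     adjacency_matrix (fst G) $ x (i, j) $ x (i + 1, j) = 1 \<and>
     adjacency_matrix (snd G) $ x (i, j) $ x (i, j + 1) = 1}"

end

theory Submission
  imports Defs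
begin

text \<open>
  The configuration is built along the diagonals \<open>j - i = d\<close> of the plane. Two neighbouring
  diagonals form a staircase that goes alternately right and up:
  \<open>(i, i) \<rightarrow> (i + 1, i) \<rightarrow> (i + 1, i + 1) \<rightarrow> \<dots>\<close>. A labelling of this staircase is a bi-infinite walk
  that uses \<open>H\<close>-edges and \<open>V\<close>-edges in turn, and one exists because no edge relation has a source
  or a sink.

  The hypothesis on \<open>HV\<close> and \<open>VH\<close> says exactly that every corner ``right, then up'' can be closed
  to a unit square by a path ``up, then right'' with the same ends, and conversely. Closing all
  corners of the first kind on a staircase yields labels for the next diagonal above, closing those
  of the second kind yields labels for the next diagonal below (lemmas \<open>staircase_above\<close> and
  \<open>staircase_below\<close>). Corners on the same side of a staircase do not interact, so all of them can be
  closed at once. Every edge of the grid joins two neighbouring diagonals, so a bi-infinite sequence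
  of diagonals in which neighbours form staircases is a point of the shift space.
\<close>

text \<open>
  Iterate a choice of successors to the right of \<open>a\<close> and a choice of predecessors to its left. This
  serves twice: for single vertices, to walk along a staircase, and for whole diagonals, to cross
  the plane.
\<close>
lemma bi_infinite_walk:
  assumes "a \<in> S"
    and succ: "\<And>x. x \<in> S \<Longrightarrow> \<exists>y\<in>S. R x y"
    and pred: "\<And>y. y \<in> S \<Longrightarrow> \<exists>x\<in>S. R x y"
  shows "\<exists>f :: int \<Rightarrow> 'a. \<forall>i. f i \<in> S \<and> R (f i) (f (i + 1))"
proof -
  obtain s where s: "\<And>x. x \<in> S \<Longrightarrow> s x \<in> S \<and> R x (s x)"
    using succ by metis
  obtain p where p: "\<And>y. y \<in> S \<Longrightarrow> p y \<in> S \<and> R (p y) y"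
    using pred by metis
  have s_in: "(s ^^ n) a \<in> S" and p_in: "(p ^^ n) a \<in> S" for n
    by (induction n) (use assms(1) s p in auto)
  define f where "f i = (if 0 \<le> i then (s ^^ nat i) a else (p ^^ nat (- i)) a)" for i
  have "f i \<in> S" for i
    by (simp add: f_def s_in p_in)
  moreover have "R (f i) (f (i + 1))" for i
  proof (cases "0 \<le> i")
    case True
    then have "f (i + 1) = s (f i)"
      by (simp add: f_def nat_add_distrib)
    then show ?thesis
      using s[OF s_in[of "nat i"]] True by (simp add: f_def)
  next
    case False
    then have "nat (- i) = Suc (nat (- (i + 1)))"
      by simp
    \<comment> \<open>For \<open>i = -1\<close> the right-hand side is the start \<open>a\<close>, on which both branches of \<open>f\<close> agree.\<close>
    moreover have "f (i + 1) = (p ^^ nat (- (i + 1))) a"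
      using False by (cases "i = - 1") (auto simp: f_def)
    ultimately have "f i = p (f (i + 1))"
      using False by (simp add: f_def)
    then show ?thesis
      using p \<open>\<And>i. f i \<in> S\<close> by metis
  qed
  ultimately show ?thesis
    by blast
qed

text \<open>
  Here \<open>B\<close> labels a diagonal and \<open>A\<close> the diagonal just below it, each indexed by the first coordinate:
  the right neighbour of \<open>B i\<close> is \<open>A (i + 1)\<close>, and the upper neighbour of \<open>A i\<close> is \<open>B i\<close>.
\<close>
definition staircase :: "'a rel \<Rightarrow> 'a rel \<Rightarrow> (int \<Rightarrow> 'a) \<Rightarrow> (int \<Rightarrow> 'a) \<Rightarrow> bool" where
  "staircase H V A B \<longleftrightarrow> (\<forall>i. (B i, A (i + 1)) \<in> H \<and> (A i, B i) \<in> V)"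

text \<open>
  Every second vertex of a staircase is a bi-infinite walk in \<open>H O V\<close>, and the vertices in between
  can be chosen afterwards.
\<close>
lemma staircase_exists:
  fixes H V :: "'a rel"
  assumes "Domain H = UNIV" "Range H = UNIV" "Domain V = UNIV" "Range V = UNIV"
  obtains A B where "staircase H V A B"
proof -
  have succ: "\<exists>y\<in>UNIV. (x, y) \<in> H O V" for x
    using assms by (metis Domain_iff UNIV_I relcomp.relcompI)
  have pred: "\<exists>x\<in>UNIV. (x, y) \<in> H O V" for y
    using assms by (metis Range_iff UNIV_I relcomp.relcompI)
  obtain B where "\<And>i :: int. (B i, B (i + 1)) \<in> H O V"
    using bi_infinite_walk[of undefined UNIV "\<lambda>x y. (x, y) \<in> H O V", OF UNIV_I succ pred] by blast
  then have "\<forall>i. \<exists>a. (B i, a) \<in> H \<and> (a, B (i + 1)) \<in> V"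
    by blast
  then obtain a where a: "\<And>i. (B i, a i) \<in> H \<and> (a i, B (i + 1)) \<in> V"
    by metis
  have "(a (i - 1), B i) \<in> V" for i
    using a[of "i - 1"] by simp
  then have "staircase H V (\<lambda>i. a (i - 1)) B"
    using a by (simp add: staircase_def)
  then show thesis
    by (rule that)
qed

text \<open>The corner \<open>B i \<rightarrow> A (i + 1) \<rightarrow> B (i + 1)\<close> runs right and then up; \<open>C i\<close> is its opposite corner.\<close>
lemma staircase_above:
  assumes "H O V \<subseteq> V O H" "staircase H V A B"
  shows "\<exists>C. staircase H V B C"
proof -
  have "(B i, B (i + 1)) \<in> V O H" for i
    using assms by (auto simp: staircase_def)
  then have "\<forall>i. \<exists>c. (B i, c) \<in> V \<and> (c, B (i + 1)) \<in> H"
    by blast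
  then show ?thesis
    unfolding staircase_def by metis
qed

text \<open>
  The corner \<open>A i \<rightarrow> B i \<rightarrow> A (i + 1)\<close> runs up and then right; its opposite corner has first
  coordinate \<open>i + 1\<close>.
\<close>
lemma staircase_below:
  assumes "V O H \<subseteq> H O V" "staircase H V A B"
  shows "\<exists>Z. staircase H V Z A"
proof -
  have "(A i, A (i + 1)) \<in> H O V" for i
    using assms by (auto simp: staircase_def)
  then have "\<forall>i. \<exists>z. (A i, z) \<in> H \<and> (z, A (i + 1)) \<in> V"
    by blast
  then obtain z where z: "\<And>i. (A i, z i) \<in> H \<and> (z i, A (i + 1)) \<in> V"
    by metis
  have "(z (i - 1), A i) \<in> V" for i
    using z[of "i - 1"] by simp
  then have "staircase H V (\<lambda>i. z (i - 1)) A"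
    using z by (simp add: staircase_def)
  then show ?thesis
    by blast
qed

lemma commuting_relations_tile_plane:
  fixes H V :: "'a rel"
  assumes "Domain H = UNIV" "Range H = UNIV" "Domain V = UNIV" "Range V = UNIV"
    and comm: "H O V = V O H"
  shows "\<exists>x :: int \<times> int \<Rightarrow> 'a.
    \<forall>i j. (x (i, j), x (i + 1, j)) \<in> H \<and> (x (i, j), x (i, j + 1)) \<in> V"
proof -
  obtain A B where AB: "staircase H V A B"
    using staircase_exists[OF assms(1-4)] .
  \<comment> \<open>A continuation of a diagonal on one side entails one on the other side, and the new diagonal has
    the old one on its far side. So \<open>S\<close> is closed under steps in both directions.\<close>
  define S where "S = {D. (\<exists>C. staircase H V D C) \<and> (\<exists>Z. staircase H V Z D)}"
  have above: "\<exists>C. staircase H V D C" if "staircase H V Z D" for Z D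
    using staircase_above[OF _ that] comm by simp
  have below: "\<exists>Z. staircase H V Z D" if "staircase H V D C" for D C
    using staircase_below[OF _ that] comm by simp
  have "A \<in> S"
    using AB below unfolding S_def by blast
  then have "\<exists>D :: int \<Rightarrow> int \<Rightarrow> 'a. \<forall>d. D d \<in> S \<and> staircase H V (D d) (D (d + 1))"
  proof (rule bi_infinite_walk)
    show "\<exists>Y\<in>S. staircase H V X Y" if "X \<in> S" for X
      using that above unfolding S_def by blast
    show "\<exists>X\<in>S. staircase H V X Y" if "Y \<in> S" for Y
      using that below unfolding S_def by blast
  qed
  then obtain D where D: "\<And>d :: int. staircase H V (D d) (D (d + 1))"
    by blast
  define x where "x = (\<lambda>(i, j). D (j - i) i)"
  have "(x (i, j), x (i + 1, j)) \<in> H" for i j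
    using D[of "j - (i + 1)"] by (simp add: x_def staircase_def diff_add_eq)
  moreover have "(x (i, j), x (i, j + 1)) \<in> V" for i j
    using D[of "j - i"] by (simp add: x_def staircase_def algebra_simps)
  ultimately show ?thesis
    by blast
qed

lemma adjacency_matrix_rows_nonzero_iff:
  "(\<forall>i. row i (adjacency_matrix E) \<noteq> 0) \<longleftrightarrow> Domain E = UNIV"
  by (auto simp: row_def adjacency_matrix_def vec_eq_iff)

lemma adjacency_matrix_columns_nonzero_iff:
  "(\<forall>j. column j (adjacency_matrix E) \<noteq> 0) \<longleftrightarrow> Range E = UNIV"
  by (auto simp: column_def adjacency_matrix_def vec_eq_iff)

text \<open>An entry of the product counts the paths of length two, so it vanishes only if there are none.\<close>
lemma adjacency_matrix_mult_nonzero_iff: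
  "(adjacency_matrix E ** adjacency_matrix F) $ i $ j \<noteq> 0 \<longleftrightarrow> (i, j) \<in> E O F"
proof -
  have "(adjacency_matrix E ** adjacency_matrix F) $ i $ j =
      (\<Sum>k\<in>UNIV. if (i, k) \<in> E \<and> (k, j) \<in> F then 1 else 0)"
    by (auto simp: matrix_matrix_mult_def adjacency_matrix_def intro!: sum.cong)
  also have "\<dots> \<noteq> 0 \<longleftrightarrow> (\<exists>k. (i, k) \<in> E \<and> (k, j) \<in> F)"
    by (subst sum_nonneg_eq_0_iff) auto
  finally show ?thesis
    by blast
qed

theorem corollary5:
  fixes H V :: "'v::finite rel"
  assumes "\<forall>i. row i (adjacency_matrix H) \<noteq> 0" and "\<forall>j. column j (adjacency_matrix H) \<noteq> 0"
    and "\<forall>i. row i (adjacency_matrix V) \<noteq> 0" and "\<forall>j. column j (adjacency_matrix V) \<noteq> 0"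
    and "\<forall>i j. (adjacency_matrix H ** adjacency_matrix V) $ i $ j \<noteq> 0 \<longleftrightarrow>
               (adjacency_matrix V ** adjacency_matrix H) $ i $ j \<noteq> 0"
  shows "shift_space (H, V) \<noteq> {}"
proof -
  have "H O V = V O H"
    using assms(5) unfolding adjacency_matrix_mult_nonzero_iff by auto
  with assms(1-4)[unfolded adjacency_matrix_rows_nonzero_iff adjacency_matrix_columns_nonzero_iff]
  obtain x where "\<And>(i :: int) (j :: int). (x (i, j), x (i + 1, j)) \<in> H \<and> (x (i, j), x (i, j + 1)) \<in> V"
    using commuting_relations_tile_plane by blast
  then have "x \<in> shift_space (H, V)"
    by (simp add: shift_space_def adjacency_matrix_def)
  then show ?thesis
    by blast
qed

end
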